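(* For every real number $p\ge 1$, positive $p$-energy is not monotone under edge addition; that is, for every real $p\ge1$ there exist a graph $G$ and two distinct nonadjacent vertices $u,v$ of $G$ such that \[ \mathcal E_p^+(G+uv)<\mathcal E_p^+(G). \]
   Context: Graphs are finite and simple. For a graph $G$ with adjacency eigenvalues $\lambda_i(G)$ (the eigenvalues of its adjacency matrix, counted with multiplicity) and a real number $p\ge 1$, the positive $p$-energy is \[ \mathcal E_p^+(G)=\sum_{\lambda_i(G)>0}\lambda_i(G)^p . \] For nonadjacent distinct vertices $u,v$ of $G$, $G+uv$ denotes the graph obtained from $G$ by adding the edge $uv$. Monotonicity under edge addition means $\mathcal E_p^+(G+uv)\ge \mathcal E_p^+(G)$ for every graph $G$ and every nonedge $uv$. *)

theory Defs
  imports "Jordan_Normal_Form.Char_Poly" "Graph_Theory.Pair_Digraph"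
begin

text \<open>
  A finite simple graph is a digraph satisfying \<^locale>\<open>pair_graph\<close>: finite, loop-free, without
  parallel arcs and with a symmetric arc relation. The undirected edge \<open>uv\<close> is the pair of arcs
  \<open>(u, v)\<close> and \<open>(v, u)\<close>. The empty graph is allowed.
\<close>

definition add_edge :: "'a pair_pre_digraph \<Rightarrow> 'a \<Rightarrow> 'a \<Rightarrow> 'a pair_pre_digraph" where
  "add_edge G u v = G\<lparr>parcs := parcs G \<union> {(u, v), (v, u)}\<rparr>"

text \<open>
  Rows and columns are indexed by the vertices in increasing order; the order affects the
  matrix only up to conjugation by a permutation matrix.
\<close>

definition adjacency_matrix :: "'a::linorder pair_pre_digraph \<Rightarrow> real mat" where
  "adjacency_matrix G =
    (let vs = sorted_list_of_set (pverts G); n = card (pverts G)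
     in mat n n (\<lambda>(i, j). if (vs ! i, vs ! j) \<in> parcs G then 1 else 0))"

text \<open>
  The matrix is real symmetric, so its characteristic polynomial splits over the reals and the
  multiset of real roots contains every eigenvalue with its multiplicity.
\<close>

definition adjacency_eigenvalues :: "'a::linorder pair_pre_digraph \<Rightarrow> real multiset" where
  "adjacency_eigenvalues G = proots (char_poly (adjacency_matrix G))"

definition positive_energy :: "real \<Rightarrow> 'a::linorder pair_pre_digraph \<Rightarrow> real" where
  "positive_energy p G = (\<Sum>x \<in># filter_mset (\<lambda>x. x > 0) (adjacency_eigenvalues G). x powr p)"

end

(*
  For a subset C of the group of subsets of U under symmetric difference, the Walsh functions
  c |-> (-1)^|A Int c| diagonalize the Cayley graph of C; the eigenvalue of A is the sum of the
  values on C. Take the strong product of the n-cube with a clique on N = 2^m vertices, and add the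
  perfect matching that translates the cube by a set w with at least two elements. Only the A inside
  the n-cube factor have an eigenvalue that can be positive, and for them N (1 + n - 2|A|) - 1
  changes by (-1)^|A Int w|. After division by N^(p-1) the change of the p-energy therefore tends to
  p times the sum over A of (-1)^|A Int w| max(0, 1 + n - 2|A|)^(p-1). A sum of these over a coset
  of sets w is a positive multiple of an iterated central difference of max(0, x + 1)^(p-1), and
  such differences cannot all be nonnegative. So for suitable n, w and m adding the matching lowers
  the energy, and hence so does adding one of its edges at some stage.
*)
theory Submission imports Defs
begin

section \<open>Central differences of truncated powers\<close>

text \<open>The step is 2 and nothing is divided by it. The argument type is left open: integers
  carry the sums over subsets, reals the mean value theorem.\<close>

primrec central_diff :: "nat \<Rightarrow> ('a::ring_1 \<Rightarrow> real) \<Rightarrow> 'a \<Rightarrow> real" where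
  "central_diff 0 f x = f x"
| "central_diff (Suc n) f x = central_diff n f (x + 1) - central_diff n f (x - 1)"

lemma central_diff_of_int:
  "central_diff n (\<lambda>k. f (of_int k)) k = central_diff n f (of_int k :: 'a::ring_1)"
  by (induction n arbitrary: k) simp_all

text \<open>The samples of the \<open>n\<close>-th difference at \<open>- int n\<close> lie between
  \<open>-2n\<close> and \<open>0\<close>; only the rightmost, with coefficient 1, escapes the
  vanishing of \<open>g\<close>.\<close>

lemma central_diff_minus_self:
  fixes g :: "int \<Rightarrow> real"
  assumes "\<And>k. k < 0 \<Longrightarrow> g k = 0"
  shows "central_diff n g (- int n) = g 0"
proof -
  have zero: "central_diff m g k = 0" if "k < - int m" for m k
    using that by (induction m arbitrary: k) (simp_all add: assms)
  show ?thesis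
    by (induction n) (simp_all add: zero algebra_simps)
qed

lemma central_diff_has_real_derivative:
  assumes "\<And>x. x > a \<Longrightarrow> (f has_real_derivative f' x) (at x)" and "x > a + real n"
  shows "(central_diff n f has_real_derivative central_diff n f' x) (at x)"
  using assms(2)
proof (induction n arbitrary: x)
  case 0
  moreover have "central_diff 0 f = f" by (simp add: fun_eq_iff)
  ultimately show ?case using assms(1) by simp
next
  case (Suc n)
  have *: "central_diff (Suc n) f = (\<lambda>x. central_diff n f (x + 1) - central_diff n f (x - 1))"
    by (simp add: fun_eq_iff)
  have "((\<lambda>x. central_diff n f (x + 1)) has_real_derivative central_diff n f' (x + 1)) (at x)"
    using Suc.prems by (subst DERIV_shift[symmetric]) (intro Suc.IH, simp)
  moreover have "((\<lambda>x. central_diff n f (x + (- 1))) has_real_derivative central_diff n f' (x + (- 1))) (at x)"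
    using Suc.prems by (subst DERIV_shift[symmetric]) (intro Suc.IH, simp)
  ultimately show ?case
    unfolding * by (simp add: DERIV_diff)
qed

text \<open>Each order costs one mean value theorem on an interval of length 2, hence the factor
  \<open>2 ^ n\<close>; the intermediate point moves by less than 1 each time. \<open>F j\<close>
  plays the \<open>j\<close>-th derivative, so the induction shifts \<open>F\<close>.\<close>

lemma central_diff_mean_value:
  fixes F :: "nat \<Rightarrow> real \<Rightarrow> real"
  assumes "\<And>j x. x > a \<Longrightarrow> (F j has_real_derivative F (Suc j) x) (at x)" and "x > a + real n"
  shows "\<exists>\<xi>. x - real n \<le> \<xi> \<and> \<xi> \<le> x + real n \<and> central_diff n (F 0) x = 2 ^ n * F n \<xi>"
  using assms
proof (induction n arbitrary: F x)
  case 0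
  then show ?case by auto
next
  case (Suc n)
  have "\<exists>z>x - 1. z < x + 1 \<and>
      central_diff n (F 0) (x + 1) - central_diff n (F 0) (x - 1) =
      (x + 1 - (x - 1)) * central_diff n (F (Suc 0)) z"
    using Suc.prems by (intro MVT2 central_diff_has_real_derivative[where a=a]) auto
  then obtain z where z: "x - 1 < z" "z < x + 1"
      "central_diff (Suc n) (F 0) x = 2 * central_diff n (F (Suc 0)) z"
    by auto
  have "\<exists>\<xi>. z - real n \<le> \<xi> \<and> \<xi> \<le> z + real n \<and>
      central_diff n (F (Suc 0)) z = 2 ^ n * F (Suc n) \<xi>"
    using Suc.IH[of "\<lambda>j. F (Suc j)" z] Suc.prems z(1) by simp
  then obtain \<xi> where "z - real n \<le> \<xi>" "\<xi> \<le> z + real n"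
      "central_diff n (F (Suc 0)) z = 2 ^ n * F (Suc n) \<xi>"
    by blast
  then show ?case
    using z by (intro exI[of _ \<xi>]) auto
qed

text \<open>By the mean value form the difference is \<open>2 ^ n\<close> times an
  \<open>n\<close>-th derivative, a multiple of \<open>(\<xi> + 1) powr (q - n)\<close> with
  negative exponent and \<xi> at least \<open>x - n\<close>.\<close>

lemma central_diff_powr_tendsto_0:
  fixes q :: real
  assumes "q < real n"
  shows "(central_diff n (\<lambda>x. max 0 (x + 1) powr q) \<longlongrightarrow> 0) at_top"
proof -
  \<comment> \<open>The \<open>j\<close>-th derivative, with a falling factorial as coefficient.
    Keeping the truncation makes \<open>F 0\<close> the given function, which is smooth to the right
    of -1.\<close>
  define F where "F j x = (\<Prod>i<j. q - real i) * max 0 (x + 1) powr (q - real j)" for j and x :: real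
  have der: "(F j has_real_derivative F (Suc j) x) (at x)" if "x > -1" for j x
  proof -
    have "((\<lambda>x. (\<Prod>i<j. q - real i) * (x + 1) powr (q - real j)) has_real_derivative F (Suc j) x) (at x)"
      using that by (auto intro!: derivative_eq_intros simp: F_def max_def diff_diff_eq add.commute)
    moreover have "eventually (\<lambda>y. (\<Prod>i<j. q - real i) * (y + 1) powr (q - real j) = F j y) (nhds x)"
    proof -
      have "\<forall>\<^sub>F y in nhds x. y \<in> {-1<..}"
        using that by (intro eventually_nhds_in_open) auto
      then show ?thesis
        by eventually_elim (simp add: F_def max_def)
    qed
    ultimately show ?thesis
      by (subst (asm) DERIV_cong_ev[OF refl _ refl])
  qed
  have "\<forall>x. \<exists>\<xi>. x > real n \<longrightarrow> x - real n \<le> \<xi> \<and> central_diff n (F 0) x = 2 ^ n * F n \<xi>"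
  proof
    fix x
    show "\<exists>\<xi>. x > real n \<longrightarrow> x - real n \<le> \<xi> \<and> central_diff n (F 0) x = 2 ^ n * F n \<xi>"
      using central_diff_mean_value[of "-1" F n x] der by auto
  qed
  then have "\<exists>\<xi>. \<forall>x. x > real n \<longrightarrow> x - real n \<le> \<xi> x \<and> central_diff n (F 0) x = 2 ^ n * F n (\<xi> x)"
    by (rule choice)
  then obtain \<xi> where \<xi>: "\<And>x. x > real n \<Longrightarrow> x - real n \<le> \<xi> x"
      "\<And>x. x > real n \<Longrightarrow> central_diff n (F 0) x = 2 ^ n * F n (\<xi> x)"
    by blast
  have "filterlim \<xi> at_top at_top"
  proof (rule filterlim_at_top_mono)
    show "filterlim (\<lambda>x. x - real n) at_top at_top"
      using filterlim_tendsto_add_at_top[OF tendsto_const[of "- real n"] filterlim_ident] by simp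
    show "\<forall>\<^sub>F x in at_top. x - real n \<le> \<xi> x"
      using eventually_gt_at_top[of "real n"] by eventually_elim (rule \<xi>)
  qed
  then have "filterlim (\<lambda>x. \<xi> x + 1) at_top at_top"
    using filterlim_tendsto_add_at_top[OF tendsto_const[of 1]] by (simp add: add.commute)
  then have *: "((\<lambda>x. (\<xi> x + 1) powr (q - real n)) \<longlongrightarrow> 0) at_top"
    using assms by (intro tendsto_neg_powr) auto
  have "((\<lambda>x. 2 ^ n * F n (\<xi> x)) \<longlongrightarrow> 0) at_top"
  proof (rule Lim_transform_eventually)
    show "((\<lambda>x. 2 ^ n * ((\<Prod>i<n. q - real i) * (\<xi> x + 1) powr (q - real n))) \<longlongrightarrow> 0) at_top"
      by (intro tendsto_mult_right_zero *)
    show "\<forall>\<^sub>F x in at_top. 2 ^ n * ((\<Prod>i<n. q - real i) * (\<xi> x + 1) powr (q - real n)) = 2 ^ n * F n (\<xi> x)"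
      using eventually_gt_at_top[of "real n"]
    proof eventually_elim
      case (elim x)
      then show ?case using \<xi>(1)[OF elim] by (simp add: F_def max_def)
    qed
  qed
  then have "(central_diff n (F 0) \<longlongrightarrow> 0) at_top"
    by (rule Lim_transform_eventually)
      (use eventually_gt_at_top[of "real n"] in \<open>eventually_elim, simp add: \<xi>(2)\<close>)
  then show ?thesis by (simp add: F_def[abs_def])
qed

text \<open>
  If all differences of order at least 2 were nonnegative on the nonnegative integers, then those of
  order \<open>n \<ge> r > q\<close> would be increasing with limit 0, hence nonpositive, hence 0. Constancy of the
  next lower difference extends this vanishing one step further to the left, and starting from
  large orders it reaches the point \<open>-r\<close>, where the difference of order \<open>r\<close> is \<open>1\<close>.
\<close>

lemma exists_central_diff_neg:
  fixes q :: real
  shows "\<exists>n\<ge>2. \<exists>k\<ge>0. central_diff n (\<lambda>k::int. max 0 (of_int k + 1) powr q) k < 0"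
proof (rule ccontr)
  define g where "g = (\<lambda>k::int. max 0 (of_int k + 1) powr q)"
  assume "\<not> ?thesis"
  then have nonneg: "central_diff n g k \<ge> 0" if "n \<ge> 2" "k \<ge> 0" for n k
    using that by (force simp: g_def)
  obtain r :: nat where r: "r \<ge> 2" "q < real r"
  proof -
    obtain r :: nat where "max 2 q < real r" using reals_Archimedean2 by blast
    then show ?thesis by (intro that[of r]) auto
  qed
  have lim: "(\<lambda>i. central_diff n g (k + 2 * int i)) \<longlonglongrightarrow> 0" if "n \<ge> r" for n k
  proof -
    have "filterlim (\<lambda>i. of_int k + 2 * real i) at_top sequentially"
      by (intro filterlim_tendsto_add_at_top[OF tendsto_const]
          filterlim_tendsto_pos_mult_at_top[OF tendsto_const] filterlim_real_sequentially) auto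
    moreover have "(central_diff n (\<lambda>x. max 0 (x + 1) powr q) \<longlongrightarrow> 0) at_top"
      using r that by (intro central_diff_powr_tendsto_0) simp
    ultimately have "(\<lambda>i. central_diff n (\<lambda>x. max 0 (x + 1) powr q) (of_int k + 2 * real i)) \<longlonglongrightarrow> 0"
      by (rule filterlim_compose[rotated])
    moreover have "central_diff n g (k + 2 * int i) =
        central_diff n (\<lambda>x. max 0 (x + 1) powr q) (of_int k + 2 * real i)" for i
      unfolding g_def using central_diff_of_int[of n "\<lambda>x::real. max 0 (x + 1) powr q" "k + 2 * int i"]
      by simp
    ultimately show ?thesis by simp
  qed
  have step: "central_diff (Suc n) g (k + 2 * int i + 1) =
      central_diff n g (k + 2 * int (Suc i)) - central_diff n g (k + 2 * int i)" for n k i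
    by (simp add: algebra_simps)
  \<comment> \<open>The order stays arbitrary in the induction on \<open>j\<close>: moving one point
    to the left for order \<open>n\<close> uses the previous range for order
    \<open>Suc n\<close>.\<close>
  have zero: "central_diff n g k = 0" if "n \<ge> r" "k \<ge> - int j" for j n k
    using that
  proof (induction j arbitrary: n k)
    case 0
    have "incseq (\<lambda>i. central_diff n g (k + 2 * int i))"
    proof (rule incseq_SucI)
      fix i
      show "central_diff n g (k + 2 * int i) \<le> central_diff n g (k + 2 * int (Suc i))"
        using nonneg[of "Suc n" "k + 2 * int i + 1"] step[of n k i] 0 r by simp
    qed
    from incseq_le[OF this lim, of 0] have "central_diff n g k \<le> 0"
      using 0 by simp
    then show ?case using nonneg[of n k] 0 r by simp
  next
    case (Suc j)
    have "central_diff (Suc n) g (k + 2 * int i + 1) = 0" for i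
      using Suc.prems by (intro Suc.IH) auto
    then have eq: "central_diff n g (k + 2 * int (Suc i)) = central_diff n g (k + 2 * int i)" for i
      using step[of n k i] by simp
    have "central_diff n g (k + 2 * int i) = central_diff n g k" for i
      by (induction i) (use eq in simp_all)
    then show ?case using lim[of n k] Suc.prems by (simp add: LIMSEQ_const_iff)
  qed
  \<comment> \<open>Since \<open>0 powr q = 0\<close> for every \<open>q\<close>, the function
    \<open>g\<close> vanishes at negative integers; for \<open>q = 0\<close> it is the indicator of
    the nonnegative ones.\<close>
  have "central_diff r g (- int r) = g 0"
    by (rule central_diff_minus_self) (simp add: g_def)
  moreover have "central_diff r g (- int r) = 0"
    by (rule zero[of r r]) auto
  ultimately show False by (simp add: g_def)
qed

section \<open>Walsh functions\<close>

lemma sum_Pow_insert: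
  assumes "finite U" "x \<notin> U"
  shows "(\<Sum>A\<in>Pow (insert x U). f A) = (\<Sum>A\<in>Pow U. f A) + (\<Sum>A\<in>Pow U. f (insert x A))"
proof -
  have "inj_on (insert x) (Pow U)"
    using assms by (auto simp: inj_on_def)
  moreover have "Pow U \<inter> insert x ` Pow U = {}"
    using assms by auto
  ultimately show ?thesis
    using assms by (simp add: Pow_insert sum.union_disjoint sum.reindex)
qed

text \<open>Expanding all differences, each element of \<open>U\<close> chooses a shift by 1 or by
  -1; \<open>A\<close> collects those that chose -1, each with a sign.\<close>

lemma central_diff_eq_sum_Pow:
  fixes g :: "int \<Rightarrow> real"
  assumes "finite U"
  shows "central_diff (card U) g k = (\<Sum>A\<in>Pow U. (- 1) ^ card A * g (k + int (card U) - 2 * int (card A)))"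
  using assms
proof (induction U arbitrary: k)
  case empty
  then show ?case by simp
next
  case (insert x U)
  have "(\<Sum>A\<in>Pow U. (- 1) ^ card (insert x A) * g (k + int (card (insert x U)) - 2 * int (card (insert x A))))
      = (\<Sum>A\<in>Pow U. - ((- 1) ^ card A * g (k - 1 + int (card U) - 2 * int (card A))))"
  proof (rule sum.cong[OF refl])
    fix A assume "A \<in> Pow U"
    then have "finite A" "x \<notin> A" using insert finite_subset by auto
    then show "(- 1) ^ card (insert x A) * g (k + int (card (insert x U)) - 2 * int (card (insert x A)))
        = - ((- 1) ^ card A * g (k - 1 + int (card U) - 2 * int (card A)))"
      using insert.hyps by (simp add: algebra_simps)
  qed
  then show ?case
    using insert by (simp add: sum_Pow_insert sum_negf algebra_simps)
qed

text \<open>These are the characters of the group of subsets under symmetric difference. As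
  \<open>card\<close> is 0 on infinite sets, multiplicativity is stated for finite sets.\<close>

definition walsh :: "'a set \<Rightarrow> 'a set \<Rightarrow> real" where
  "walsh A B = (- 1) ^ card (A \<inter> B)"

lemma walsh_commute: "walsh A B = walsh B A"
  by (simp add: walsh_def Int_commute)

lemma walsh_empty [simp]: "walsh A {} = 1"
  by (simp add: walsh_def)

lemma walsh_le_1: "walsh A B \<le> 1"
  by (cases "even (card (A \<inter> B))") (simp_all add: walsh_def)

text \<open>Elements common to \<open>A\<close>, \<open>B\<close> and \<open>C\<close> are counted
  twice on the right, which does not affect the sign.\<close>

lemma walsh_sym_diff:
  assumes "finite B" "finite C"
  shows "walsh A (sym_diff B C) = walsh A B * walsh A C"
proof -
  have "card (A \<inter> B) = card (A \<inter> (B - C)) + card (A \<inter> B \<inter> C)"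
    using assms by (subst card_Un_disjoint[symmetric]) (auto intro!: arg_cong[where f=card])
  moreover have "card (A \<inter> C) = card (A \<inter> (C - B)) + card (A \<inter> B \<inter> C)"
    using assms by (subst card_Un_disjoint[symmetric]) (auto intro!: arg_cong[where f=card])
  moreover have "card (A \<inter> sym_diff B C) = card (A \<inter> (B - C)) + card (A \<inter> (C - B))"
    using assms by (subst card_Un_disjoint[symmetric]) (auto intro!: arg_cong[where f=card])
  ultimately show ?thesis
    by (simp add: walsh_def power_add flip: power_mult_distrib)
qed

lemma walsh_Un_disjoint:
  assumes "finite B" "finite C" "B \<inter> C = {}"
  shows "walsh A (B \<union> C) = walsh A B * walsh A C"
proof -
  have "B \<union> C = sym_diff B C" using assms by blast
  then show ?thesis using walsh_sym_diff assms by metis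
qed

text \<open>Orthogonality of characters: each \<open>x\<close> in \<open>U\<close> contributes a
  factor \<open>1 + walsh A {x}\<close>, which is 2 or, for \<open>x\<close> in \<open>A\<close>,
  0.\<close>

lemma sum_walsh_Pow:
  assumes "finite U"
  shows "(\<Sum>B\<in>Pow U. walsh A B) = (if A \<inter> U = {} then 2 ^ card U else 0)"
  using assms
proof (induction U)
  case (insert x U)
  have "(\<Sum>B\<in>Pow U. walsh A (insert x B)) = (\<Sum>B\<in>Pow U. walsh A {x} * walsh A B)"
  proof (rule sum.cong[OF refl])
    fix B assume "B \<in> Pow U"
    then show "walsh A (insert x B) = walsh A {x} * walsh A B"
      using walsh_Un_disjoint[of "{x}" B A] insert.hyps by (auto dest: finite_subset)
  qed
  also have "\<dots> = walsh A {x} * (\<Sum>B\<in>Pow U. walsh A B)"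
    by (simp add: sum_distrib_left)
  finally show ?case
    using insert by (auto simp: sum_Pow_insert walsh_def)
qed simp

text \<open>Summing over \<open>w\<close> first kills every \<open>A\<close> that meets
  \<open>L\<close>, by orthogonality; on the remaining \<open>A \<subseteq> K\<close> the sign
  \<open>walsh A K\<close> is \<open>(- 1) ^ card A\<close>.\<close>

lemma sum_walsh_coset:
  assumes "finite K" "finite L" "K \<inter> L = {}"
  shows "(\<Sum>w\<in>Pow L. \<Sum>A\<in>Pow (K \<union> L). walsh A (K \<union> w) * f A) = 2 ^ card L * (\<Sum>A\<in>Pow K. (- 1) ^ card A * f A)"
proof -
  have "(\<Sum>w\<in>Pow L. \<Sum>A\<in>Pow (K \<union> L). walsh A (K \<union> w) * f A)
      = (\<Sum>A\<in>Pow (K \<union> L). \<Sum>w\<in>Pow L. walsh A (K \<union> w) * f A)"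
    by (rule sum.swap)
  also have "\<dots> = (\<Sum>A\<in>Pow (K \<union> L). walsh A K * f A * (\<Sum>w\<in>Pow L. walsh A w))"
  proof (rule sum.cong[OF refl])
    fix A
    have "walsh A (K \<union> w) = walsh A K * walsh A w" if "w \<in> Pow L" for w
      using that assms by (intro walsh_Un_disjoint) (auto dest: finite_subset)
    then show "(\<Sum>w\<in>Pow L. walsh A (K \<union> w) * f A) = walsh A K * f A * (\<Sum>w\<in>Pow L. walsh A w)"
      by (simp add: sum_distrib_left mult_ac)
  qed
  also have "\<dots> = (\<Sum>A\<in>Pow K. walsh A K * f A * 2 ^ card L)"
    using assms by (intro sum.mono_neutral_cong_right) (auto simp: sum_walsh_Pow)
  also have "\<dots> = (\<Sum>A\<in>Pow K. (- 1) ^ card A * f A * 2 ^ card L)"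
    by (intro sum.cong refl) (auto simp: walsh_def Int_absorb2)
  finally show ?thesis
    by (simp add: sum_distrib_left mult_ac)
qed

text \<open>Summing over all sets between \<open>{..<d}\<close> and \<open>{..<n}\<close> gives a
  positive multiple of a negative \<open>d\<close>-th difference, so one of these sets has a
  negative sum.\<close>

lemma exists_walsh_sum_neg:
  fixes q :: real
  shows "\<exists>n. \<exists>w\<subseteq>{..<n}. 2 \<le> card w \<and>
    (\<Sum>A\<in>Pow {..<n}. walsh A w * max 0 (1 + real n - 2 * real (card A)) powr q) < 0"
proof -
  obtain d k where d: "d \<ge> 2" and k: "k \<ge> 0"
    and neg: "central_diff d (\<lambda>k::int. max 0 (of_int k + 1) powr q) k < 0"
    using exists_central_diff_neg[of q] by blast
  \<comment> \<open>With this \<open>n\<close> the samples \<open>k + d - 2 * card A\<close>, raised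
    by 1, are the values \<open>1 + n - 2 * card A\<close>.\<close>
  define n where "n = d + nat k"
  define f where "f = (\<lambda>A :: nat set. max 0 (1 + real n - 2 * real (card A)) powr q)"
  have fn: "f A = max 0 (of_int (k + int (card {..<d}) - 2 * int (card A)) + 1) powr q" for A
    using k by (simp add: f_def n_def algebra_simps)
  have "(\<Sum>A\<in>Pow {..<d}. (- 1) ^ card A * f A) = central_diff (card {..<d}) (\<lambda>k::int. max 0 (of_int k + 1) powr q) k"
    unfolding fn by (rule central_diff_eq_sum_Pow[symmetric]) simp
  then have "2 ^ card {d..<n} * (\<Sum>A\<in>Pow {..<d}. (- 1) ^ card A * f A) < 0"
    using neg by (simp add: mult_pos_neg)
  moreover have "{..<n} = {..<d} \<union> {d..<n}" by (auto simp: n_def)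
  ultimately have "(\<Sum>w\<in>Pow {d..<n}. \<Sum>A\<in>Pow {..<n}. walsh A ({..<d} \<union> w) * f A) < 0"
    using sum_walsh_coset[of "{..<d}" "{d..<n}" f] by (simp add: ivl_disj_int_one)
  then have "\<not> (\<forall>w\<in>Pow {d..<n}. (\<Sum>A\<in>Pow {..<n}. walsh A ({..<d} \<union> w) * f A) \<ge> 0)"
    using sum_nonneg[of "Pow {d..<n}" "\<lambda>w. \<Sum>A\<in>Pow {..<n}. walsh A ({..<d} \<union> w) * f A"] by fastforce
  then obtain w where w: "w \<subseteq> {d..<n}" "(\<Sum>A\<in>Pow {..<n}. walsh A ({..<d} \<union> w) * f A) < 0"
    by (auto simp: not_le)
  have "card {..<d} \<le> card ({..<d} \<union> w)"
    using w by (intro card_mono) (auto dest: finite_subset)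
  moreover have "{..<d} \<union> w \<subseteq> {..<n}" using w by (auto simp: n_def)
  ultimately show ?thesis
    using w(2) d unfolding f_def by (intro exI[of _ n] exI[of _ "{..<d} \<union> w"] conjI) simp_all
qed

section \<open>The spectrum of Cayley graphs on subsets\<close>

text \<open>Nonpositive eigenvalues can stay in the sum because \<open>0 powr p = 0\<close>.\<close>

lemma sum_mset_filter_pos_powr:
  fixes M :: "real multiset"
  shows "(\<Sum>x\<in>#filter_mset (\<lambda>x. x > 0) M. x powr p) = (\<Sum>x\<in>#M. max 0 x powr p)"
  by (induction M) (auto simp: max_def)

lemma proots_prod_list_linear:
  "proots (\<Prod>a\<leftarrow>xs. [:- a, 1:]) = mset (xs :: 'a::idom list)"
proof (induction xs)
  case (Cons a xs)
  have "(\<Prod>a\<leftarrow>xs. [:- a, 1:]) \<noteq> 0"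
    by (auto simp: prod_list_zero_iff)
  then show ?case
    using Cons by (simp add: proots_mult del: mult_pCons_left)
qed simp

lemma mset_map_upt_bij:
  assumes "bij_betw h {..<N} S"
  shows "mset (map (\<lambda>i. f (h i)) [0..<N]) = image_mset f (mset_set S)"
proof -
  have "mset_set S = image_mset h (mset_set {..<N})"
    using image_mset_mset_set[of h "{..<N}"] assms by (simp add: bij_betw_def)
  also have "mset_set {..<N} = mset [0..<N]"
    by (simp only: mset_upt atLeast0LessThan)
  finally show ?thesis by (simp add: image_mset.compositionality o_def)
qed

text \<open>Vertices must be linearly ordered for the adjacency matrix, so subsets are represented
  by their numbers under \<open>h\<close>.\<close>

definition cayley_graph :: "(nat \<Rightarrow> 'a set) \<Rightarrow> nat \<Rightarrow> 'a set set \<Rightarrow> nat pair_pre_digraph" where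
  "cayley_graph h N C = \<lparr>pverts = {..<N}, parcs = {(i, j). i < N \<and> j < N \<and> sym_diff (h i) (h j) \<in> C}\<rparr>"

text \<open>The Walsh-Hadamard matrix \<open>H\<close> squares to \<open>N\<close> times the
  identity and its columns are eigenvectors. So the adjacency matrix is similar to the diagonal
  matrix \<open>D\<close>, which yields the eigenvalues with multiplicity.\<close>

lemma adjacency_eigenvalues_cayley_graph:
  assumes U: "finite U" and h: "bij_betw h {..<N} (Pow U)" and C: "C \<subseteq> Pow U"
  shows "adjacency_eigenvalues (cayley_graph h N C) =
    image_mset (\<lambda>A. \<Sum>c\<in>C. walsh A c) (mset_set (Pow U))"
proof -
  define ev where "ev = (\<lambda>A. \<Sum>c\<in>C. walsh A c)"
  define H where "H = mat N N (\<lambda>(i, j). walsh (h i) (h j))"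
  define D where "D = mat_diag N (\<lambda>i. ev (h i))"
  define M where "M = adjacency_matrix (cayley_graph h N C)"
  have M: "M = mat N N (\<lambda>(i, j). if sym_diff (h i) (h j) \<in> C then 1 else 0)"
    by (auto simp: M_def adjacency_matrix_def cayley_graph_def Let_def lessThan_atLeast0 intro!: eq_matI)
  have N: "real N = 2 ^ card U"
    using bij_betw_same_card[OF h] U by (simp add: card_Pow)
  have hU: "h i \<subseteq> U" "finite (h i)" if "i < N" for i
  proof -
    show "h i \<subseteq> U" using h that by (auto simp: bij_betw_def)
    then show "finite (h i)" using U finite_subset by blast
  qed
  have sum_h: "(\<Sum>k = 0..<N. f (h k)) = (\<Sum>K\<in>Pow U. f K)" for f :: "'a set \<Rightarrow> real"
    using sum.reindex_bij_betw[OF h, of f] by (simp add: lessThan_atLeast0)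
  have [simp]: "H \<in> carrier_mat N N" "D \<in> carrier_mat N N" "M \<in> carrier_mat N N"
    by (simp_all add: H_def D_def M)
  have HH: "H * H = real N \<cdot>\<^sub>m 1\<^sub>m N"
  proof (rule eq_matI)
    fix i j assume "i < dim_row (real N \<cdot>\<^sub>m 1\<^sub>m N)" "j < dim_col (real N \<cdot>\<^sub>m 1\<^sub>m N)"
    then have ij: "i < N" "j < N" by auto
    have "(H * H) $$ (i, j) = (\<Sum>k = 0..<N. walsh (h i) (h k) * walsh (h k) (h j))"
      using ij by (simp add: H_def scalar_prod_def)
    also have "\<dots> = (\<Sum>K\<in>Pow U. walsh (h i) K * walsh K (h j))"
      by (rule sum_h)
    also have "\<dots> = (\<Sum>K\<in>Pow U. walsh (sym_diff (h i) (h j)) K)"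
      using ij hU by (intro sum.cong refl) (simp add: walsh_sym_diff walsh_commute)
    also have "\<dots> = (if i = j then real N else 0)"
    proof -
      have "sym_diff (h i) (h j) \<inter> U = {} \<longleftrightarrow> h i = h j"
        using hU ij by blast
      also have "\<dots> \<longleftrightarrow> i = j"
        using h ij by (auto simp: bij_betw_def inj_on_def)
      finally show ?thesis using U by (simp add: sum_walsh_Pow N)
    qed
    finally show "(H * H) $$ (i, j) = (real N \<cdot>\<^sub>m 1\<^sub>m N) $$ (i, j)"
      using ij by simp
  qed (simp_all add: H_def)
  have MH: "M * H = H * D"
  proof (rule eq_matI)
    fix i j assume "i < dim_row (H * D)" "j < dim_col (H * D)"
    then have ij: "i < N" "j < N" by (auto simp: H_def D_def mat_diag_def)
    have "(M * H) $$ (i, j) = (\<Sum>k = 0..<N. (if sym_diff (h i) (h k) \<in> C then 1 else 0) * walsh (h k) (h j))"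
      using ij by (simp add: M H_def scalar_prod_def)
    also have "\<dots> = (\<Sum>K\<in>Pow U. (if sym_diff (h i) K \<in> C then 1 else 0) * walsh K (h j))"
      by (rule sum_h)
    also have "\<dots> = (\<Sum>K\<in>{K\<in>Pow U. sym_diff (h i) K \<in> C}. walsh K (h j))"
      using U by (intro sum.mono_neutral_cong_right) auto
    \<comment> \<open>Substitute \<open>K = sym_diff (h i) c\<close>; translation by
      \<open>h i\<close> is an involution.\<close>
    also have "\<dots> = (\<Sum>c\<in>C. walsh (sym_diff (h i) c) (h j))"
    proof -
      have cancel: "sym_diff (h i) (sym_diff (h i) K) = K" for K by blast
      show ?thesis
        by (rule sum.reindex_bij_witness[where i="sym_diff (h i)" and j="sym_diff (h i)"])
          (simp_all only: cancel mem_Collect_eq, use hU(1)[OF ij(1)] C in auto)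
    qed
    also have "\<dots> = (\<Sum>c\<in>C. walsh (h i) (h j) * walsh (h j) c)"
    proof (rule sum.cong[OF refl])
      fix c assume "c \<in> C"
      then have "finite c" using C U by (auto dest: finite_subset)
      then show "walsh (sym_diff (h i) c) (h j) = walsh (h i) (h j) * walsh (h j) c"
        using hU(2)[OF ij(1)] walsh_sym_diff[of "h i" c "h j"] by (simp add: walsh_commute)
    qed
    also have "\<dots> = (H * D) $$ (i, j)"
      unfolding D_def using ij by (subst mat_diag_mult_right[of H N N]) (simp_all add: H_def ev_def sum_distrib_left)
    finally show "(M * H) $$ (i, j) = (H * D) $$ (i, j)" .
  qed (simp_all add: H_def D_def M mat_diag_def)
  define Q where "Q = (1 / real N) \<cdot>\<^sub>m H"
  have [simp]: "Q \<in> carrier_mat N N" by (simp add: Q_def)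
  have N0: "real N \<noteq> 0" using N by simp
  have HQ: "H * Q = 1\<^sub>m N"
    unfolding Q_def using N0 by (subst mult_smult_distrib[of H N N H N]) (simp_all add: HH, auto intro!: eq_matI)
  have QH: "Q * H = 1\<^sub>m N"
    unfolding Q_def using N0 by (subst mult_smult_assoc_mat[of H N N H N]) (simp_all add: HH, auto intro!: eq_matI)
  have "M = M * (H * Q)" by (simp add: HQ right_mult_one_mat[of M N N])
  also have "\<dots> = H * D * Q"
    by (simp add: assoc_mult_mat[of M N N H N Q N, symmetric] MH)
  finally have MD: "M = H * D * Q" .
  have "similar_mat M D"
    by (rule similar_matI[OF _ HQ QH MD]) simp
  then have "char_poly M = (\<Prod>a\<leftarrow>diag_mat D. [:- a, 1:])"
    by (subst char_poly_similar, assumption, intro char_poly_upper_triangular[of D N])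
      (auto simp: D_def mat_diag_def)
  moreover have "diag_mat D = map (\<lambda>i. ev (h i)) [0..<N]"
    by (auto simp: diag_mat_def D_def mat_diag_def)
  ultimately have "proots (char_poly M) = image_mset ev (mset_set (Pow U))"
    by (simp only: proots_prod_list_linear mset_map_upt_bij[OF h])
  then show ?thesis
    by (simp add: adjacency_eigenvalues_def M_def ev_def)
qed

lemma positive_energy_cayley_graph:
  assumes "finite U" "bij_betw h {..<N} (Pow U)" "C \<subseteq> Pow U"
  shows "positive_energy p (cayley_graph h N C) = (\<Sum>A\<in>Pow U. max 0 (\<Sum>c\<in>C. walsh A c) powr p)"
  unfolding positive_energy_def adjacency_eigenvalues_cayley_graph[OF assms] sum_mset_filter_pos_powr
  by (simp add: sum_unfold_sum_mset image_mset.compositionality o_def)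

section \<open>Adding edges one at a time\<close>

lemma pair_graphI:
  assumes "finite (pverts G)" "parcs G \<subseteq> pverts G \<times> pverts G" "sym (parcs G)"
    and "\<And>u. (u, u) \<notin> parcs G"
  shows "pair_graph G"
proof -
  have "finite (parcs G)"
    using assms(1,2) finite_subset by blast
  then show ?thesis
    using assms by unfold_locales (auto simp: symmetric_def arcs_ends_def arc_to_ends_def)
qed

lemma pair_graph_cayley_graph:
  assumes "{} \<notin> C"
  shows "pair_graph (cayley_graph h N C)"
  using assms by (intro pair_graphI) (auto simp: cayley_graph_def sym_def Un_commute)

lemma pair_graph_add_edge:
  assumes "pair_graph G" "u \<in> pverts G" "v \<in> pverts G" "u \<noteq> v"
  shows "pair_graph (add_edge G u v)"
proof -
  interpret pair_graph G by fact
  have "(x, x) \<notin> parcs G" for x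
    using pair_no_loops[of "(x, x)"] by auto
  then show ?thesis
    using assms pair_finite_verts pair_sym_arcs
    by (intro pair_graphI)
      (auto simp: add_edge_def symmetric_def arcs_ends_def arc_to_ends_def sym_def dest: in_arcsD1 in_arcsD2)
qed

text \<open>Used in contrapositive form: a drop from a graph to a larger one on the same vertices
  forces a drop at a single edge. The induction is on the number of missing arcs.\<close>

lemma mono_add_edge_imp_mono_subgraph:
  fixes E :: "'a pair_pre_digraph \<Rightarrow> real"
  assumes mono: "\<And>G u v. pair_graph G \<Longrightarrow> u \<in> pverts G \<Longrightarrow> v \<in> pverts G \<Longrightarrow> u \<noteq> v \<Longrightarrow>
      (u, v) \<notin> parcs G \<Longrightarrow> E G \<le> E (add_edge G u v)"
    and "pair_graph G" "pair_graph G'" "pverts G = pverts G'" "parcs G \<subseteq> parcs G'"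
  shows "E G \<le> E G'"
  using assms(2-)
proof (induction "card (parcs G' - parcs G)" arbitrary: G rule: less_induct)
  case less
  interpret G': pair_graph G' by fact
  show ?case
  proof (cases "parcs G' \<subseteq> parcs G")
    case True
    then have "G = G'" using less.prems by simp
    then show ?thesis by simp
  next
    case False
    then obtain u v where uv: "(u, v) \<in> parcs G'" "(u, v) \<notin> parcs G" by auto
    then have vu: "(v, u) \<in> parcs G'"
      using G'.pair_sym_arcs by (auto simp: symmetric_def arcs_ends_def arc_to_ends_def sym_def)
    have verts: "u \<in> pverts G" "v \<in> pverts G" "u \<noteq> v"
      using uv less.prems(3) G'.in_arcsD1 G'.in_arcsD2 G'.pair_no_loops[of "(u, v)"] by auto
    have "E G \<le> E (add_edge G u v)"
      using uv verts less.prems by (intro mono)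
    also have "\<dots> \<le> E G'"
    proof (rule less.hyps)
      show "card (parcs G' - parcs (add_edge G u v)) < card (parcs G' - parcs G)"
        using uv G'.pair_finite_arcs by (intro psubset_card_mono) (auto simp: add_edge_def)
      show "pair_graph (add_edge G u v)"
        using less.prems verts by (intro pair_graph_add_edge)
    qed (use uv vu less.prems in \<open>auto simp: add_edge_def\<close>)
    finally show ?thesis .
  qed
qed

section \<open>The strong product of a cube and a clique\<close>

text \<open>The summation set is the closed neighbourhood of \<open>{}\<close> in the strong product
  of the cube on \<open>L\<close> with the clique on \<open>Pow R\<close>. Keeping \<open>{}\<close>
  in it lets the sum factor over \<open>L\<close> and \<open>R\<close>.\<close>

lemma sum_walsh_closed_nbhd:
  assumes A: "finite L" "finite R" "L \<inter> R = {}"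
  shows "(\<Sum>c\<in>{c\<in>Pow (L \<union> R). card (c \<inter> L) \<le> 1}. walsh A c) =
    (if A \<inter> R = {} then 2 ^ card R * (1 + real (card L) - 2 * real (card (A \<inter> L))) else 0)"
proof -
  let ?X = "{x\<in>Pow L. card x \<le> 1}"
  have X: "?X = insert {} ((\<lambda>i. {i}) ` L)"
  proof -
    have "x \<in> insert {} ((\<lambda>i. {i}) ` L)" if "x \<subseteq> L" "card x \<le> 1" for x
    proof -
      have "finite x" using that A finite_subset by blast
      then have "x = {} \<or> (\<exists>i. x = {i})"
        using that by (cases "card x") (auto simp: card_1_singleton_iff)
      then show ?thesis using that by auto
    qed
    then show ?thesis by auto
  qed
  have "(\<Sum>c\<in>{c\<in>Pow (L \<union> R). card (c \<inter> L) \<le> 1}. walsh A c) = (\<Sum>(x, s)\<in>?X \<times> Pow R. walsh A (x \<union> s))"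
  proof -
    have "x \<inter> L = x" "s \<inter> L = {}" if "x \<subseteq> L" "s \<subseteq> R" for x s
      using that A by auto
    moreover have "c \<inter> L \<union> c \<inter> R = c" if "c \<subseteq> L \<union> R" for c
      using that by auto
    ultimately show ?thesis using A
      by (intro sum.reindex_bij_witness[where i="\<lambda>(x, s). x \<union> s" and j="\<lambda>c. (c \<inter> L, c \<inter> R)"])
        (auto simp: Int_Un_distrib2)
  qed
  also have "\<dots> = (\<Sum>(x, s)\<in>?X \<times> Pow R. walsh A x * walsh A s)"
  proof (intro sum.cong refl, clarify)
    fix x s assume "x \<subseteq> L" "s \<subseteq> R"
    then show "walsh A (x \<union> s) = walsh A x * walsh A s"
      using A by (intro walsh_Un_disjoint) (auto dest: finite_subset)
  qed
  also have "\<dots> = (\<Sum>x\<in>?X. walsh A x) * (\<Sum>s\<in>Pow R. walsh A s)"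
    by (simp add: sum_product sum.cartesian_product)
  also have "(\<Sum>x\<in>?X. walsh A x) = 1 + (\<Sum>i\<in>L. walsh A {i})"
    unfolding X using A by (subst sum.insert) (auto simp: sum.reindex)
  also have "(\<Sum>i\<in>L. walsh A {i}) = (\<Sum>i\<in>L. 1 - 2 * of_bool (i \<in> A))"
    by (intro sum.cong refl) (auto simp: walsh_def)
  also have "\<dots> = real (card L) - 2 * real (card (A \<inter> L))"
    using A by (simp add: sum_subtractf sum_distrib_left[symmetric] Int_commute)
  finally show ?thesis
    using A by (simp add: sum_walsh_Pow)
qed

section \<open>Asymptotic change of a truncated power under a bounded perturbation\<close>

text \<open>For \<open>x > 0\<close> this is a derivative at 0 in the variable \<open>1 / N\<close>.
  For \<open>x \<le> 0\<close> both truncations vanish once \<open>N > 0\<close>, because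
  \<open>s \<le> 1\<close>, and so does the limit, even for \<open>p = 1\<close>, as
  \<open>0 powr 0 = 0\<close>.\<close>

lemma powr_increment_tendsto:
  fixes p s x :: real
  assumes "s \<le> 1"
  shows "((\<lambda>N. (max 0 (N * x - 1 + s) powr p - max 0 (N * x - 1) powr p) / N powr (p - 1))
    \<longlongrightarrow> p * s * max 0 x powr (p - 1)) at_top"
proof (cases "x > 0")
  case False
  have "\<forall>\<^sub>F N in at_top. 0 = (max 0 (N * x - 1 + s) powr p - max 0 (N * x - 1) powr p) / N powr (p - 1)"
    using eventually_gt_at_top[of 0]
  proof eventually_elim
    case (elim N)
    then have "N * x \<le> 0" using False by (simp add: mult_nonneg_nonpos)
    then show ?case using assms by (simp add: max_def)
  qed
  then show ?thesis
    using False by (intro Lim_transform_eventually[OF tendsto_const]) (auto simp: max_def intro: tendsto_eq_rhs)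
next
  case True
  \<comment> \<open>Here \<open>e\<close> stands for \<open>1 / N\<close>. Since
    \<open>\<phi> 0 = 0\<close>, the quotient \<open>\<phi> e / e\<close> is a difference quotient
    at 0.\<close>
  define \<phi> where "\<phi> = (\<lambda>e. (x + (s - 1) * e) powr p - (x - e) powr p)"
  have "(\<phi> has_real_derivative p * s * x powr (p - 1)) (at 0)"
    unfolding \<phi>_def using True by (auto intro!: derivative_eq_intros simp: algebra_simps)
  then have "((\<lambda>e. \<phi> e / e) \<longlongrightarrow> p * s * x powr (p - 1)) (at 0)"
    by (simp add: has_field_derivative_iff \<phi>_def)
  then have "((\<lambda>e. \<phi> e / e) \<longlongrightarrow> p * s * x powr (p - 1)) (at_right 0)"
    by (rule filterlim_mono[OF _ order.refl]) (simp add: at_le)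
  then have "((\<lambda>N. \<phi> (inverse N) / inverse N) \<longlongrightarrow> p * s * x powr (p - 1)) at_top"
    by (rule filterlim_compose[OF _ filterlim_inverse_at_right_top])
  then have lim: "((\<lambda>N. \<phi> (inverse N) / inverse N) \<longlongrightarrow> p * s * max 0 x powr (p - 1)) at_top"
    using True by (simp add: max_def)
  have "\<forall>\<^sub>F N in at_top. \<phi> (inverse N) / inverse N =
      (max 0 (N * x - 1 + s) powr p - max 0 (N * x - 1) powr p) / N powr (p - 1)"
    \<comment> \<open>Beyond this bound \<open>N * x > 1 + |s|\<close>, so both truncations are
      inactive.\<close>
    using eventually_gt_at_top[of "max 1 ((1 + \<bar>s\<bar>) / x)"]
  proof eventually_elim
    case (elim N)
    then have N: "N > 0" "N * x > 1 + \<bar>s\<bar>" using True by (auto simp: field_simps)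
    have "N * x - 1 + s = N * (x + (s - 1) * inverse N)" "N * x - 1 = N * (x - inverse N)"
      using N by (simp_all add: field_simps)
    moreover have "N * x - 1 + s > 0" "N * x - 1 > 0" using N by auto
    ultimately have "max 0 (N * x - 1 + s) powr p = N powr p * (x + (s - 1) * inverse N) powr p"
        "max 0 (N * x - 1) powr p = N powr p * (x - inverse N) powr p"
      using N(1) by (auto simp: max_def powr_mult zero_less_mult_iff)
    moreover have "(a - b) / inverse N = (N powr p * a - N powr p * b) / N powr (p - 1)" for a b
      using N(1) by (simp add: powr_diff field_simps)
    ultimately show ?case by (simp only: \<phi>_def)
  qed
  with lim show ?thesis by (rule Lim_transform_eventually)
qed

theorem corollary1:
  fixes p :: real
  assumes "p \<ge> 1"
  shows "\<exists>(G :: nat pair_pre_digraph) u v.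
    pair_graph G \<and> u \<in> pverts G \<and> v \<in> pverts G \<and> u \<noteq> v \<and> (u, v) \<notin> parcs G \<and>
    positive_energy p (add_edge G u v) < positive_energy p G"
proof -
  obtain n w where w: "w \<subseteq> {..<n}" "2 \<le> card w"
    and neg: "(\<Sum>A\<in>Pow {..<n}. walsh A w * max 0 (1 + real n - 2 * real (card A)) powr (p - 1)) < 0"
    using exists_walsh_sum_neg[of "p - 1"] by blast
  define \<mu> where "\<mu> A = 1 + real n - 2 * real (card A)" for A :: "nat set"
  \<comment> \<open>The scaled change of the energy caused by the matching of \<open>w\<close>, with
    the clique size relaxed to a real \<open>N\<close>.\<close>
  define \<Delta> where "\<Delta> N = (\<Sum>A\<in>Pow {..<n}.
    (max 0 (N * \<mu> A - 1 + walsh A w) powr p - max 0 (N * \<mu> A - 1) powr p) / N powr (p - 1))" for N :: real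
  have "(\<Delta> \<longlongrightarrow> (\<Sum>A\<in>Pow {..<n}. p * walsh A w * max 0 (\<mu> A) powr (p - 1))) at_top"
    unfolding \<Delta>_def by (intro tendsto_sum powr_increment_tendsto walsh_le_1)
  moreover have "(\<Sum>A\<in>Pow {..<n}. p * walsh A w * max 0 (\<mu> A) powr (p - 1)) < 0"
    using neg assms by (simp add: \<mu>_def mult.assoc mult_pos_neg flip: sum_distrib_left)
  ultimately have "\<forall>\<^sub>F N in at_top. \<Delta> N < 0"
    by (rule order_tendstoD)
  \<comment> \<open>The clique will be on the subsets of an \<open>m\<close>-element set, so only
    the sizes \<open>2 ^ m\<close> are available.\<close>
  moreover have "filterlim (\<lambda>m. 2 ^ m :: real) at_top sequentially"
    by (intro filterlim_at_infinity_imp_filterlim_at_top[OF filterlim_realpow_sequentially_gt1]) simp_all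
  ultimately have "\<forall>\<^sub>F m in sequentially. \<Delta> (2 ^ m) < 0"
    by (rule eventually_compose_filterlim)
  then obtain m where "\<Delta> (2 ^ m) < 0"
    using eventually_happens'[OF sequentially_bot] by blast
  then have decrease: "(\<Sum>A\<in>Pow {..<n}. max 0 (2 ^ m * \<mu> A - 1 + walsh A w) powr p)
      < (\<Sum>A\<in>Pow {..<n}. max 0 (2 ^ m * \<mu> A - 1) powr p)"
    by (simp add: \<Delta>_def sum_subtractf divide_less_0_iff flip: sum_divide_distrib)

  \<comment> \<open>The first \<open>n\<close> coordinates carry the cube, the other
    \<open>m\<close> the clique.\<close>
  define U where "U = {..<n} \<union> {n..<n + m}"
  \<comment> \<open>Removing \<open>{}\<close> removes the loops and accounts for the
    \<open>- 1\<close> in the eigenvalues.\<close>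
  define C where "C = {c\<in>Pow U. card (c \<inter> {..<n}) \<le> 1} - {{}}"
  have U: "finite U" by (simp add: U_def)
  then obtain h where "bij_betw h {0..<card (Pow U)} (Pow U)"
    using ex_bij_betw_nat_finite[of "Pow U"] by auto
  \<comment> \<open>From here on \<open>N\<close> is the number of vertices, no longer the clique
    size.\<close>
  then obtain N where h: "bij_betw h {..<N} (Pow U)"
    by (auto simp: lessThan_atLeast0)
  have finC: "finite C" and CU: "C \<subseteq> Pow U" and wU: "w \<in> Pow U"
    using U w by (auto simp: C_def U_def)
  \<comment> \<open>Two elements inside the cube part make \<open>w\<close> a new connection, and a
    nonempty \<open>w\<close> adds no loops.\<close>
  have wC: "w \<notin> C" and w0: "w \<noteq> {}"
    using w by (auto simp: C_def Int_absorb2)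
  have ev: "(\<Sum>c\<in>C. walsh A c) = (if A \<inter> {n..<n + m} = {} then 2 ^ m * \<mu> A else 0) - 1"
    if "A \<subseteq> U" for A
  proof -
    have "(\<Sum>c\<in>C. walsh A c) = (\<Sum>c\<in>{c\<in>Pow U. card (c \<inter> {..<n}) \<le> 1}. walsh A c) - 1"
      using U unfolding C_def by (subst sum_diff1) auto
    moreover have "A \<inter> {..<n} = A" if "A \<inter> {n..<n + m} = {}"
      using that \<open>A \<subseteq> U\<close> by (auto simp: U_def)
    moreover have "{..<n} \<inter> {n..<n + m} = {}" by auto
    ultimately show ?thesis
      using sum_walsh_closed_nbhd[of "{..<n}" "{n..<n + m}" A] by (auto simp: U_def \<mu>_def)
  qed
  txt \<open>Sets meeting \<open>{n..<n + m}\<close> give the eigenvalue \<open>-1\<close>, and adding a perturbation \<open>t \<le> 1\<close> does not make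
    it positive. This is why the vertices are blown up into cliques and not into independent sets.\<close>
  have energy: "(\<Sum>A\<in>Pow U. max 0 ((\<Sum>c\<in>C. walsh A c) + t A) powr p)
      = (\<Sum>A\<in>Pow {..<n}. max 0 (2 ^ m * \<mu> A - 1 + t A) powr p)" if "\<And>A. t A \<le> 1" for t
  proof (intro sum.mono_neutral_cong_right ballI)
    fix A assume "A \<in> Pow U - Pow {..<n}"
    then have "A \<subseteq> U" "A \<inter> {n..<n + m} \<noteq> {}" by (auto simp: U_def)
    then show "max 0 ((\<Sum>c\<in>C. walsh A c) + t A) powr p = 0"
      using that[of A] by (simp add: ev max_def)
  next
    fix A assume "A \<in> Pow {..<n}"
    then have "A \<subseteq> U" "A \<inter> {n..<n + m} = {}" by (auto simp: U_def)
    then show "max 0 ((\<Sum>c\<in>C. walsh A c) + t A) powr p = max 0 (2 ^ m * \<mu> A - 1 + t A) powr p"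
      by (simp add: ev)
  qed (auto simp: U_def)
  have "positive_energy p (cayley_graph h N C) = (\<Sum>A\<in>Pow {..<n}. max 0 (2 ^ m * \<mu> A - 1) powr p)"
    using positive_energy_cayley_graph[OF U h CU, of p] energy[of "\<lambda>_. 0"] by simp
  moreover have "positive_energy p (cayley_graph h N (insert w C)) =
      (\<Sum>A\<in>Pow {..<n}. max 0 (2 ^ m * \<mu> A - 1 + walsh A w) powr p)"
  proof -
    have "insert w C \<subseteq> Pow U" using CU wU by simp
    then show ?thesis
      using positive_energy_cayley_graph[OF U h, of "insert w C" p] energy[of "\<lambda>A. walsh A w", OF walsh_le_1] wC finC
      by (simp add: add.commute)
  qed
  ultimately have "\<not> positive_energy p (cayley_graph h N C) \<le> positive_energy p (cayley_graph h N (insert w C))"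
    using decrease by simp
  moreover have "pair_graph (cayley_graph h N C)" "pair_graph (cayley_graph h N (insert w C))"
    using w0 by (auto intro!: pair_graph_cayley_graph simp: C_def)
  moreover have "pverts (cayley_graph h N C) = pverts (cayley_graph h N (insert w C))"
      "parcs (cayley_graph h N C) \<subseteq> parcs (cayley_graph h N (insert w C))"
    by (auto simp: cayley_graph_def)
  ultimately show ?thesis
    using mono_add_edge_imp_mono_subgraph[of "positive_energy p"] by (metis linorder_not_le)
qed

end
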